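(* Let $\{\mathcal{T}(t)\}_{t\ge 0}$ be the asymmetric telegraph process with velocities $c_1,-c_2$ ($c_1,c_2>0$) and rate $\lambda>0$, and let $t>0$. For every integer $k\ge 1$, $$P\Big\{\max_{0\le s\le t}\mathcal{T}(s)=0\ \Big|\ V(0)=-c_2,\ N(t)=2k-1\Big\}=P\Big\{\max_{0\le s\le t}\mathcal{T}(s)=0\ \Big|\ V(0)=-c_2,\ N(t)=2k\Big\}.$$
   Context: Asymmetric telegraph process: let $c_1,c_2>0$, $\lambda>0$. Let $\{N(t)\}_{t\ge0}$ be a homogeneous Poisson process with rate $\lambda$, and let $V(0)$ be a random variable independent of $N$ with $P\{V(0)=c_1\}=P\{V(0)=-c_2\}=\frac12$. The velocity $V(s)$ takes values in $\{c_1,-c_2\}$, starts at $V(0)$, and switches from one of these two values to the other at each event of $N$, remaining constant between events. The position of the particle is $\mathcal{T}(t)=\int_0^t V(s)\,ds$ (so $\mathcal{T}(0)=0$). *)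

theory Defs
  imports "HOL-Probability.Probability"
begin

locale poisson_process = prob_space M
  for M :: "'a measure" and rate :: real and N :: "real \<Rightarrow> 'a \<Rightarrow> nat" +
  assumes rate_pos: "rate > 0"
    and N_measurable: "\<And>s. s \<ge> 0 \<Longrightarrow> N s \<in> measurable M (count_space UNIV)"
    and N_zero: "\<And>\<omega>. \<omega> \<in> space M \<Longrightarrow> N 0 \<omega> = 0"
    and N_mono: "\<And>\<omega> s u. \<omega> \<in> space M \<Longrightarrow> 0 \<le> s \<Longrightarrow> s \<le> u \<Longrightarrow> N s \<omega> \<le> N u \<omega>"
    and N_right_continuous:
      "\<And>\<omega> s. \<omega> \<in> space M \<Longrightarrow> 0 \<le> s \<Longrightarrow> continuous (at_right s) (\<lambda>u. N u \<omega>)"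
    and N_increments:
      "\<And>s u. 0 \<le> s \<Longrightarrow> s < u \<Longrightarrow>
        distr M (count_space UNIV) (\<lambda>\<omega>. N u \<omega> - N s \<omega>) = measure_pmf (poisson_pmf (rate * (u - s)))"
    and N_indep_increments:
      "\<And>(n::nat) \<tau>. 0 \<le> \<tau> 0 \<Longrightarrow> (\<And>i. i < n \<Longrightarrow> \<tau> i < \<tau> (Suc i)) \<Longrightarrow>
        indep_vars (\<lambda>_. count_space UNIV) (\<lambda>i \<omega>. N (\<tau> (Suc i)) \<omega> - N (\<tau> i) \<omega>) {..<n}"

text \<open>Independence of \<^term>\<open>V0\<close> from the whole process, not merely from each \<^term>\<open>N s\<close>:
  the process is regarded as one random element of the product space indexed by the
  nonnegative reals. The generated sigma-algebras are used because \<^const>\<open>prob_space.indep_var\<close>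
  requires both random variables to have the same value type.\<close>

locale telegraph_process = poisson_process M rate N
  for M :: "'a measure" and rate :: real and N :: "real \<Rightarrow> 'a \<Rightarrow> nat" +
  fixes c1 c2 :: real and V0 :: "'a \<Rightarrow> real"
  assumes c1_pos: "c1 > 0" and c2_pos: "c2 > 0"
    and V0_measurable: "V0 \<in> borel_measurable M"
    and V0_c1: "prob {\<omega> \<in> space M. V0 \<omega> = c1} = 1 / 2"
    and V0_c2: "prob {\<omega> \<in> space M. V0 \<omega> = - c2} = 1 / 2"
    and V0_indep:
      "indep_set (sets (vimage_algebra (space M) V0 borel))
        (sets (vimage_algebra (space M) (\<lambda>\<omega>. \<lambda>s\<in>{0..}. N s \<omega>) (Pi\<^sub>M {0..} (\<lambda>_. count_space UNIV))))"

text \<open>Each of the \<^term>\<open>N s \<omega>\<close> events up to time \<^term>\<open>s\<close> exchanges the two velocities, so only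
  the parity of their number matters.\<close>

definition telegraph_velocity ::
    "real \<Rightarrow> real \<Rightarrow> ('a \<Rightarrow> real) \<Rightarrow> (real \<Rightarrow> 'a \<Rightarrow> nat) \<Rightarrow> real \<Rightarrow> 'a \<Rightarrow> real" where
  "telegraph_velocity c1 c2 V0 N s \<omega> =
     (if even (N s \<omega>) then V0 \<omega> else if V0 \<omega> = c1 then - c2 else c1)"

definition telegraph_position ::
    "real \<Rightarrow> real \<Rightarrow> ('a \<Rightarrow> real) \<Rightarrow> (real \<Rightarrow> 'a \<Rightarrow> nat) \<Rightarrow> real \<Rightarrow> 'a \<Rightarrow> real" where
  "telegraph_position c1 c2 V0 N t \<omega> = integral {0..t} (\<lambda>s. telegraph_velocity c1 c2 V0 N s \<omega>)"

text \<open>Paths of the position are continuous, so the supremum over the compact interval is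
  attained and is the maximum.\<close>

definition telegraph_max ::
    "real \<Rightarrow> real \<Rightarrow> ('a \<Rightarrow> real) \<Rightarrow> (real \<Rightarrow> 'a \<Rightarrow> nat) \<Rightarrow> real \<Rightarrow> 'a \<Rightarrow> real" where
  "telegraph_max c1 c2 V0 N t \<omega> = (SUP s\<in>{0..t}. telegraph_position c1 c2 V0 N s \<omega>)"

end

theory Submission
  imports Defs
begin

text \<open>Let the path start downwards and let \<open>n = 2 * k - 1\<close>.  With \<open>n + 1\<close> events the velocity after
the last event is negative, so the maximum is the one attained up to the last event.  Up to that
time the path is a telegraph path with \<open>n\<close> events on a shorter interval, and given the time of
the last event the other \<open>n\<close> events are distributed as they are on an interval that is known to
contain exactly \<open>n\<close> events.  Whether the maximum is 0 does not change when time is rescaled, so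
the conditional probability given \<open>n + 1\<close> events is an average of equal numbers, all of them the
conditional probability given \<open>n\<close> events.

The proof carries this out on a grid, without the joint law of the event times.  On a grid with \<open>m\<close>
cells the path is described by independent Poisson counts, and for a given number of events the
maximum is known up to a fixed multiple of the cell width (\<open>path_max_grid_max\<close>).  Scale invariance becomes the remark that,
conditionally on their sum, the counts of \<open>j\<close> cells have a distribution that does not depend on the
cell width (\<open>past_scaling\<close>).  Decomposing with respect to the cell of the last event gives an
inequality between the two conditional laws of the maximum, up to a tolerance
(\<open>last_event_transfer\<close>).  A refinement of the grid gives the inequality for a positive maximum
(\<open>prob_path_max_gt_le\<close>) and for a maximum that is at most 0 (\<open>prob_path_max_le_le\<close>).  These are
complementary events, so two inequalities in the same direction yield equality; in particular it is
enough to bound probabilities from above throughout, and the chance that the maximum changes within the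
cell of the last event never has to be estimated.\<close>

section \<open>Paths and their discretisation\<close>

text \<open>The velocity of a path that starts downwards, as a function of the number of events so far.  On the
event \<open>V0 = - c2\<close> it depends on \<open>\<omega>\<close> through the counting path alone, which
makes every later functional a functional of \<open>N\<close>.\<close>

definition velocity_after :: "real \<Rightarrow> real \<Rightarrow> nat \<Rightarrow> real" where
  "velocity_after c1 c2 n = (if even n then - c2 else c1)"

definition path_max :: "real \<Rightarrow> real \<Rightarrow> (real \<Rightarrow> nat) \<Rightarrow> real \<Rightarrow> real" where
  "path_max c1 c2 g t = (SUP s\<in>{0..t}. integral {0..s} (\<lambda>u. velocity_after c1 c2 (g u)))"

text \<open>The maximum of the walk that takes its velocity at the left end of each cell, measured in units of
the cell width.  Leaving the width out is what makes this functional free of time scale.\<close>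

definition grid_max :: "real \<Rightarrow> real \<Rightarrow> (nat \<Rightarrow> nat) \<Rightarrow> nat \<Rightarrow> real" where
  "grid_max c1 c2 y m = (MAX i\<in>{..m}. \<Sum>l<i. velocity_after c1 c2 (y l))"

lemma abs_velocity_after_le:
  assumes "c1 > 0" "c2 > 0"
  shows "\<bar>velocity_after c1 c2 n\<bar> \<le> c1 + c2"
  using assms by (simp add: velocity_after_def)

lemma abs_velocity_after_diff_le:
  assumes "c1 > 0" "c2 > 0"
  shows "\<bar>velocity_after c1 c2 n - velocity_after c1 c2 n'\<bar> \<le> c1 + c2"
  using assms by (simp add: velocity_after_def)

text \<open>A monotone counting path is Borel measurable; it is frozen on the negative axis, where nothing is
known about it, to make it monotone on the whole line.\<close>

lemma velocity_after_integrable: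
  fixes g :: "real \<Rightarrow> nat"
  assumes mono: "mono_on {0..} g" and "0 \<le> a"
    and c: "c1 > 0" "c2 > 0"
  shows "(\<lambda>u. velocity_after c1 c2 (g u)) integrable_on {a..b}"
proof -
  define G where "G u = g (max 0 u)" for u
  have "mono (\<lambda>u. real (G u))"
    unfolding G_def mono_def by (auto intro!: mono_onD[OF mono] simp: max_def)
  then have "(\<lambda>u. real (G u)) \<in> borel_measurable borel"
    by (rule borel_measurable_mono)
  then have "(\<lambda>u. nat \<lfloor>real (G u)\<rfloor>) \<in> borel \<rightarrow>\<^sub>M count_space UNIV"
    by measurable
  then have "G \<in> borel \<rightarrow>\<^sub>M count_space UNIV"
    by simp
  then have "(\<lambda>u. velocity_after c1 c2 (G u)) \<in> borel_measurable borel"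
    by measurable
  moreover have "AE x in lborel. x \<in> {a..b} \<longrightarrow> norm (velocity_after c1 c2 (G x)) \<le> c1 + c2"
    using abs_velocity_after_le[OF c] by simp
  ultimately have "set_integrable lborel {a..b} (\<lambda>u. velocity_after c1 c2 (G u))"
    unfolding set_integrable_def
    by (intro integrableI_bounded_set_indicator[where B = "c1 + c2"])
      (auto simp: emeasure_lborel_Icc_eq)
  then have "(\<lambda>u. velocity_after c1 c2 (G u)) integrable_on {a..b}"
    by (rule set_borel_integral_eq_integral(1))
  then show ?thesis
    by (rule integrable_eq) (use \<open>0 \<le> a\<close> in \<open>auto simp: G_def max_def\<close>)
qed

lemma integral_velocity_after_bound:
  fixes g :: "real \<Rightarrow> nat"
  assumes mono: "mono_on {0..} g" and "0 \<le> a" "a \<le> b"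
    and c: "c1 > 0" "c2 > 0"
  shows "\<bar>integral {a..b} (\<lambda>u. velocity_after c1 c2 (g u))\<bar> \<le> (c1 + c2) * (b - a)"
proof -
  have "norm (integral (cbox a b) (\<lambda>u. velocity_after c1 c2 (g u)))
      \<le> (c1 + c2) * measure lborel (cbox a b)"
    using velocity_after_integrable[OF mono \<open>0 \<le> a\<close> c, where b = b] abs_velocity_after_le[OF c] c
    by (intro has_integral_bound[OF _ integrable_integral]) auto
  then show ?thesis using assms by simp
qed

text \<open>Freezing the velocity on a cell is exact unless the count increases there, and an increase of an
integer-valued count is at least 1.  Writing the error as a multiple of the increment lets it
telescope over the grid.\<close>

lemma integral_velocity_after_cell:
  fixes g :: "real \<Rightarrow> nat"
  assumes mono: "mono_on {0..} g" and "0 \<le> a" "a \<le> b"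
    and c: "c1 > 0" "c2 > 0"
  shows "\<bar>integral {a..b} (\<lambda>u. velocity_after c1 c2 (g u)) - (b - a) * velocity_after c1 c2 (g a)\<bar>
    \<le> (c1 + c2) * (b - a) * (real (g b) - real (g a))"
proof (cases "g a = g b")
  case True
  have const: "g u = g a" if "u \<in> {a..b}" for u
  proof (rule antisym)
    show "g u \<le> g a"
      unfolding True using that \<open>0 \<le> a\<close> by (intro mono_onD[OF mono]) auto
    show "g a \<le> g u"
      using that \<open>0 \<le> a\<close> by (intro mono_onD[OF mono]) auto
  qed
  have "integral {a..b} (\<lambda>u. velocity_after c1 c2 (g u))
      = integral {a..b} (\<lambda>u. velocity_after c1 c2 (g a))"
    by (rule integral_cong) (drule const, simp only:)
  then show ?thesis using True \<open>a \<le> b\<close> by simp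
next
  case False
  with mono_onD[OF mono, of a b] assms have ge: "real (g b) - real (g a) \<ge> 1" by simp
  have "norm (integral (cbox a b) (\<lambda>u. velocity_after c1 c2 (g u) - velocity_after c1 c2 (g a)))
      \<le> (c1 + c2) * measure lborel (cbox a b)"
    using velocity_after_integrable[OF mono \<open>0 \<le> a\<close> c, where b = b] abs_velocity_after_diff_le[OF c] c
    by (intro has_integral_bound[OF _ integrable_integral]) (auto intro!: integrable_diff)
  moreover have "integral (cbox a b) (\<lambda>u. velocity_after c1 c2 (g u) - velocity_after c1 c2 (g a))
     = integral {a..b} (\<lambda>u. velocity_after c1 c2 (g u)) - (b - a) * velocity_after c1 c2 (g a)"
    using velocity_after_integrable[OF mono \<open>0 \<le> a\<close> c, where b = b] \<open>a \<le> b\<close> by (subst integral_diff) auto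
  ultimately have "\<bar>integral {a..b} (\<lambda>u. velocity_after c1 c2 (g u))
      - (b - a) * velocity_after c1 c2 (g a)\<bar> \<le> (c1 + c2) * (b - a) * 1"
    using \<open>a \<le> b\<close> by simp
  also have "\<dots> \<le> (c1 + c2) * (b - a) * (real (g b) - real (g a))"
    using ge c \<open>a \<le> b\<close> by (intro mult_left_mono) auto
  finally show ?thesis .
qed

lemma integral_velocity_after_grid:
  fixes g :: "real \<Rightarrow> nat"
  assumes mono: "mono_on {0..} g" and "0 < h"
    and c: "c1 > 0" "c2 > 0"
  shows "\<bar>integral {0..real i * h} (\<lambda>u. velocity_after c1 c2 (g u))
      - h * (\<Sum>l<i. velocity_after c1 c2 (g (real l * h)))\<bar> \<le> (c1 + c2) * h * real (g (real i * h))"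
proof (induction i)
  case 0
  then show ?case using assms by simp
next
  case (Suc i)
  let ?f = "\<lambda>u. velocity_after c1 c2 (g u)"
  have split: "integral {0..real (Suc i) * h} ?f
      = integral {0..real i * h} ?f + integral {real i * h..real (Suc i) * h} ?f"
    using velocity_after_integrable[OF mono order.refl c] \<open>0 < h\<close>
    by (intro Henstock_Kurzweil_Integration.integral_combine[symmetric]) auto
  have "\<bar>integral {real i * h..real (Suc i) * h} ?f
      - (real (Suc i) * h - real i * h) * ?f (real i * h)\<bar>
    \<le> (c1 + c2) * (real (Suc i) * h - real i * h)
      * (real (g (real (Suc i) * h)) - real (g (real i * h)))"
    using \<open>0 < h\<close> by (intro integral_velocity_after_cell mono c) auto
  moreover have "real (Suc i) * h - real i * h = h"
    by (simp add: algebra_simps)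
  ultimately have cell: "\<bar>integral {real i * h..real (Suc i) * h} ?f - h * ?f (real i * h)\<bar>
    \<le> (c1 + c2) * h * (real (g (real (Suc i) * h)) - real (g (real i * h)))"
    by simp
  have "h * (\<Sum>l<Suc i. ?f (real l * h)) = h * (\<Sum>l<i. ?f (real l * h)) + h * ?f (real i * h)"
    by (simp add: distrib_left)
  then show ?case
    using split cell Suc.IH unfolding right_diff_distrib by linarith
qed

lemma bdd_above_positions:
  fixes g :: "real \<Rightarrow> nat"
  assumes mono: "mono_on {0..} g"
    and c: "c1 > 0" "c2 > 0"
  shows "bdd_above ((\<lambda>s. integral {0..s} (\<lambda>u. velocity_after c1 c2 (g u))) ` {0..t})"
proof (rule bdd_aboveI2)
  fix s assume s: "s \<in> {0..t}"
  have "\<bar>integral {0..s} (\<lambda>u. velocity_after c1 c2 (g u))\<bar> \<le> (c1 + c2) * (s - 0)"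
    using s by (intro integral_velocity_after_bound mono c) auto
  also have "\<dots> \<le> (c1 + c2) * t"
    using s c by (intro mult_left_mono) auto
  finally show "integral {0..s} (\<lambda>u. velocity_after c1 c2 (g u)) \<le> (c1 + c2) * t"
    by simp
qed

lemma path_max_nonneg:
  fixes g :: "real \<Rightarrow> nat"
  assumes mono: "mono_on {0..} g"
    and c: "c1 > 0" "c2 > 0" and "0 \<le> t"
  shows "0 \<le> path_max c1 c2 g t"
proof -
  have "integral {0..0} (\<lambda>u. velocity_after c1 c2 (g u)) \<le> path_max c1 c2 g t"
    unfolding path_max_def using \<open>0 \<le> t\<close>
    by (intro cSUP_upper bdd_above_positions mono c) auto
  then show ?thesis by simp
qed

text \<open>The error is at most \<open>c1 + c2\<close> times the cell width for every event, and once more for the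
position inside a cell.  For each path it vanishes with the cell width, at a rate that depends on
the path only through its final count.\<close>

lemma path_max_grid_max:
  fixes g :: "real \<Rightarrow> nat"
  assumes mono: "mono_on {0..} g"
    and c: "c1 > 0" "c2 > 0" and "0 < t" "0 < m"
  shows "\<bar>path_max c1 c2 g t - t / real m * grid_max c1 c2 (\<lambda>l. g (real l * (t / real m))) m\<bar>
    \<le> (c1 + c2) * (t / real m) * (real (g t) + 1)"
proof -
  define h where "h = t / real m"
  let ?C = "c1 + c2"
  define T where "T s = integral {0..s} (\<lambda>u. velocity_after c1 c2 (g u))" for s
  define w where "w i = (\<Sum>l<i. velocity_after c1 c2 (g (real l * h)))" for i
  define G where "G = Max (w ` {..m})"
  have h: "h > 0" and mh: "real m * h = t"
    using \<open>0 < t\<close> \<open>0 < m\<close> by (auto simp: h_def)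
  have Tw: "\<bar>T (real i * h) - h * w i\<bar> \<le> ?C * h * real (g t)" if "i \<le> m" for i
  proof -
    have "real i * h \<le> t"
      using that h unfolding mh[symmetric] by (intro mult_right_mono) auto
    then have "g (real i * h) \<le> g t" using h \<open>0 < t\<close> by (intro mono_onD[OF mono]) auto
    then have "?C * h * real (g (real i * h)) \<le> ?C * h * real (g t)"
      using h c by (intro mult_left_mono) auto
    then show ?thesis
      using integral_velocity_after_grid[OF mono h c, where i = i] unfolding T_def w_def by linarith
  qed
  have wG: "w i \<le> G" if "i \<le> m" for i
    unfolding G_def using that by (intro Max_ge) auto
  have "path_max c1 c2 g t \<le> h * G + ?C * h * (real (g t) + 1)"
    unfolding path_max_def
  proof (rule cSUP_least)
    show "{0..t} \<noteq> {}" using \<open>0 < t\<close> by simp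
    fix s assume s: "s \<in> {0..t}"
    define i where "i = nat \<lfloor>s / h\<rfloor>"
    have "0 \<le> s / h" using s h by simp
    then have i: "real i \<le> s / h" "s / h < real i + 1"
      unfolding i_def by linarith+
    then have ih: "real i * h \<le> s" "s \<le> real i * h + h"
      using h by (simp_all add: field_simps)
    have "real i * h \<le> real m * h" using ih s mh by simp
    then have "i \<le> m" using h by simp
    have "T s = T (real i * h) + integral {real i * h..s} (\<lambda>u. velocity_after c1 c2 (g u))"
      unfolding T_def using ih h velocity_after_integrable[OF mono order.refl c]
      by (intro Henstock_Kurzweil_Integration.integral_combine[symmetric]) auto
    moreover have "\<bar>integral {real i * h..s} (\<lambda>u. velocity_after c1 c2 (g u))\<bar>
        \<le> ?C * (s - real i * h)"
      using ih h by (intro integral_velocity_after_bound mono c) auto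
    moreover have "?C * (s - real i * h) \<le> ?C * h"
      using ih c by (intro mult_left_mono) auto
    moreover have "h * w i \<le> h * G"
      using wG[OF \<open>i \<le> m\<close>] h by simp
    moreover note Tw[OF \<open>i \<le> m\<close>]
    ultimately have "T s \<le> h * G + ?C * h + ?C * h * real (g t)"
      by linarith
    then show "integral {0..s} (\<lambda>u. velocity_after c1 c2 (g u)) \<le> h * G + ?C * h * (real (g t) + 1)"
      unfolding T_def distrib_left mult_1_right by linarith
  qed
  moreover have "h * G - ?C * h * (real (g t) + 1) \<le> path_max c1 c2 g t"
  proof -
    have "G \<in> w ` {..m}" unfolding G_def by (intro Max_in) auto
    then obtain i where i: "i \<le> m" "G = w i" by auto
    have "real i * h \<in> {0..t}"
      using i h unfolding mh[symmetric] by (auto intro!: mult_right_mono)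
    then have "T (real i * h) \<le> path_max c1 c2 g t"
      unfolding path_max_def T_def by (intro cSUP_upper bdd_above_positions mono c)
    moreover have "0 \<le> ?C * h" using c h by simp
    moreover have "?C * h * (real (g t) + 1) = ?C * h * real (g t) + ?C * h"
      by (simp add: distrib_left)
    ultimately show ?thesis using Tw[OF i(1)] unfolding i(2) by linarith
  qed
  moreover have "G = grid_max c1 c2 (\<lambda>l. g (real l * h)) m"
    unfolding G_def w_def grid_max_def ..
  ultimately show ?thesis
    unfolding h_def[symmetric] by (simp add: abs_le_iff)
qed

lemma grid_max_cong:
  assumes "\<And>l. l < m \<Longrightarrow> y l = y' l"
  shows "grid_max c1 c2 y m = grid_max c1 c2 y' m"
proof -
  have "(\<Sum>l<i. velocity_after c1 c2 (y l)) = (\<Sum>l<i. velocity_after c1 c2 (y' l))" if "i \<le> m" for i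
    using assms that by (intro sum.cong) auto
  then show ?thesis unfolding grid_max_def by (intro arg_cong[where f = Max] image_cong) auto
qed

text \<open>From cell \<open>j + 1\<close> on the walk only descends, so after cell \<open>j\<close> the
maximum can rise by the single upward step of cell \<open>j\<close> at most.\<close>

lemma grid_max_last_event:
  assumes c: "c1 > 0" "c2 > 0" and "j < m" "odd (y j)"
    and after: "\<And>l. j < l \<Longrightarrow> l < m \<Longrightarrow> even (y l)"
  shows "grid_max c1 c2 y j \<le> grid_max c1 c2 y m" "grid_max c1 c2 y m \<le> grid_max c1 c2 y j + c1"
proof -
  define w where "w i = (\<Sum>l<i. velocity_after c1 c2 (y l))" for i
  have gm: "grid_max c1 c2 y i = Max (w ` {..i})" for i
    unfolding grid_max_def w_def ..
  show "grid_max c1 c2 y j \<le> grid_max c1 c2 y m"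
    unfolding gm using \<open>j < m\<close> by (intro Max_mono) auto
  have late: "w (Suc j + i) \<le> w j + c1" if "Suc j + i \<le> m" for i
    using that
  proof (induction i)
    case 0
    then show ?case using \<open>odd (y j)\<close> by (simp add: w_def velocity_after_def)
  next
    case (Suc i)
    then have "w (Suc j + i) \<le> w j + c1" by simp
    moreover have "w (Suc j + Suc i) = w (Suc j + i) - c2"
      using after[of "Suc (j + i)"] Suc.prems by (simp add: w_def velocity_after_def)
    ultimately show ?case using c by simp
  qed
  show "grid_max c1 c2 y m \<le> grid_max c1 c2 y j + c1"
    unfolding gm
  proof (rule Max.boundedI)
    fix a assume "a \<in> w ` {..m}"
    then obtain i where i: "i \<le> m" "a = w i" by auto
    have *: "w i' \<le> Max (w ` {..j})" if "i' \<le> j" for i'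
      using that by (intro Max_ge) auto
    show "a \<le> Max (w ` {..j}) + c1"
    proof (cases "i \<le> j")
      case True
      then show ?thesis using *[of i] i c by linarith
    next
      case False
      then have "w i \<le> w j + c1" using late[of "i - Suc j"] i by simp
      then show ?thesis using *[of j] i by linarith
    qed
  qed auto
qed

lemma last_event_cell:
  fixes y :: "nat \<Rightarrow> nat"
  assumes "mono y" "y 0 = 0" "y m = Suc n"
    and single: "\<And>i. i < m \<Longrightarrow> y (Suc i) - y i < 2"
  shows "\<exists>j<m. y j = n \<and> (\<forall>l. j < l \<and> l \<le> m \<longrightarrow> y l = Suc n)"
proof -
  define l where "l = (LEAST l. y l = Suc n)"
  have yl: "y l = Suc n" unfolding l_def using \<open>y m = Suc n\<close> by (rule LeastI)
  have "l \<le> m" unfolding l_def using \<open>y m = Suc n\<close> by (rule Least_le)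
  have "l \<noteq> 0" using yl \<open>y 0 = 0\<close> by (intro notI) simp
  then obtain j where j: "l = Suc j" by (cases l) auto
  have "y j \<noteq> Suc n" using not_less_Least[of j "\<lambda>l. y l = Suc n"] j unfolding l_def by auto
  moreover have "y j \<le> Suc n" using monoD[OF \<open>mono y\<close>, of j l] yl j by simp
  moreover have "Suc n - y j < 2" using single[of j] yl j \<open>l \<le> m\<close> by simp
  ultimately have "y j = n" by linarith
  moreover have "y i = Suc n" if "j < i" "i \<le> m" for i
    using monoD[OF \<open>mono y\<close>, of l i] monoD[OF \<open>mono y\<close>, of i m] that j yl \<open>y m = Suc n\<close> by simp
  ultimately show ?thesis using j \<open>l \<le> m\<close> by (intro exI[of _ j]) auto
qed

section \<open>Poisson counts on a grid\<close>

context poisson_process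
begin

definition cell_count :: "real \<Rightarrow> nat \<Rightarrow> 'a \<Rightarrow> nat" where
  "cell_count h i \<omega> = N (real (Suc i) * h) \<omega> - N (real i * h) \<omega>"

lemma mono_on_path: "\<omega> \<in> space M \<Longrightarrow> mono_on {0..} (\<lambda>s. N s \<omega>)"
  by (rule mono_onI) (auto intro: N_mono)

lemma cell_count_measurable:
  assumes "0 < h"
  shows "cell_count h i \<in> M \<rightarrow>\<^sub>M count_space UNIV"
proof -
  have [measurable]: "N (real (Suc i) * h) \<in> M \<rightarrow>\<^sub>M count_space UNIV"
      "N (real i * h) \<in> M \<rightarrow>\<^sub>M count_space UNIV"
    using assms by (intro N_measurable; simp)+
  show ?thesis unfolding cell_count_def by measurable
qed

text \<open>The counts determine the path on the grid, so a statement about the path at grid times is one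
about independent Poisson variables.\<close>

lemma sum_cell_count:
  assumes "\<omega> \<in> space M" "0 < h"
  shows "(\<Sum>i<j. cell_count h i \<omega>) = N (real j * h) \<omega>"
proof (induction j)
  case 0
  then show ?case using N_zero assms by simp
next
  case (Suc j)
  have "N (real j * h) \<omega> \<le> N (real (Suc j) * h) \<omega>"
    using assms by (intro N_mono) auto
  then show ?case
    using Suc by (simp add: cell_count_def del: of_nat_Suc)
qed

lemma prob_cell_count:
  assumes "0 < h"
  shows "prob {\<omega> \<in> space M. cell_count h i \<omega> \<in> A} = measure_pmf.prob (poisson_pmf (rate * h)) A"
proof -
  have "real (Suc i) * h - real i * h = h" by (simp add: algebra_simps)
  moreover have "distr M (count_space UNIV) (\<lambda>\<omega>. N (real (Suc i) * h) \<omega> - N (real i * h) \<omega>)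
      = measure_pmf (poisson_pmf (rate * (real (Suc i) * h - real i * h)))"
    using assms by (intro N_increments) auto
  ultimately have "distr M (count_space UNIV) (cell_count h i) = measure_pmf (poisson_pmf (rate * h))"
    by (simp add: cell_count_def[abs_def])
  moreover have "measure (distr M (count_space UNIV) (cell_count h i)) A
      = prob (cell_count h i -` A \<inter> space M)"
    using cell_count_measurable[OF assms] by (intro measure_distr) auto
  ultimately show ?thesis
    by (simp add: vimage_def Int_def conj_commute)
qed

lemma prob_cell_count_eq:
  assumes "0 < h"
  shows "prob {\<omega> \<in> space M. cell_count h i \<omega> = x} = (rate * h) ^ x / fact x * exp (- (rate * h))"
  using prob_cell_count[OF assms, of i "{x}"] assms rate_pos by (simp add: measure_pmf_single)

lemma prob_cell_counts:
  assumes "0 < h"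
  shows "prob {\<omega> \<in> space M. \<forall>i<m. cell_count h i \<omega> = x i}
    = (\<Prod>i<m. (rate * h) ^ x i / fact (x i) * exp (- (rate * h)))"
proof (cases "m = 0")
  case True
  then show ?thesis using prob_space by simp
next
  case False
  have "indep_vars (\<lambda>_. count_space UNIV)
      (\<lambda>i \<omega>. N (real (Suc i) * h) \<omega> - N (real i * h) \<omega>) {..<m}"
    using assms by (intro N_indep_increments) auto
  then have "indep_vars (\<lambda>_. count_space UNIV) (cell_count h) {..<m}"
    by (simp add: cell_count_def[abs_def])
  then have "prob (\<Inter>i\<in>{..<m}. cell_count h i -` {x i} \<inter> space M)
      = (\<Prod>i<m. prob (cell_count h i -` {x i} \<inter> space M))"
    using False by (intro indep_varsD_finite) auto
  moreover have "(\<Inter>i\<in>{..<m}. cell_count h i -` {x i} \<inter> space M)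
      = {\<omega> \<in> space M. \<forall>i<m. cell_count h i \<omega> = x i}"
    using False by auto
  moreover have "cell_count h i -` {x i} \<inter> space M = {\<omega> \<in> space M. cell_count h i \<omega> = x i}" for i
    by auto
  ultimately show ?thesis
    using prob_cell_count_eq[OF assms] by simp
qed

text \<open>A count vector \<open>x\<close> with sum \<open>n\<close> on the first \<open>j\<close> cells has
probability \<open>\<Prod>i<j. (rate * h) ^ x i / fact (x i) * exp (- (rate * h))\<close>, and here the cell
width enters only through \<open>(rate * h) ^ n * exp (- (rate * h)) ^ j\<close>, which is the same for all
such vectors.  Hence the three factors: the combinatorial weight of the past event
\<open>B\<close>, a factor that carries the scale, and the prescribed future.  Only finitely many vectors
have sum \<open>n\<close>, so \<open>B\<close> may be any predicate.\<close>

lemma prob_past_future: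
  fixes B :: "(nat \<Rightarrow> nat) \<Rightarrow> bool" and y :: "nat \<Rightarrow> nat" and n :: nat
  assumes "0 < h" "j \<le> m"
  defines "E \<equiv> {\<omega> \<in> space M. B (\<lambda>i\<in>{..<j}. cell_count h i \<omega>) \<and> N (real j * h) \<omega> = n
    \<and> (\<forall>i. j \<le> i \<and> i < m \<longrightarrow> cell_count h i \<omega> = y i)}"
  shows "E \<in> events"
    and "prob E = (\<Sum>x\<in>{x \<in> {..<j} \<rightarrow>\<^sub>E {..n}. sum x {..<j} = n \<and> B x}. \<Prod>i<j. 1 / fact (x i))
      * ((rate * h) ^ n * exp (- (rate * h)) ^ j)
      * (\<Prod>i\<in>{j..<m}. (rate * h) ^ y i / fact (y i) * exp (- (rate * h)))"
proof -
  define K where "K = {x \<in> {..<j} \<rightarrow>\<^sub>E {..n}. sum x {..<j} = n \<and> B x}"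
  define z where "z x i = (if i < j then x i else y i)" for x :: "nat \<Rightarrow> nat" and i
  define F where "F x = {\<omega> \<in> space M. \<forall>i<m. cell_count h i \<omega> = z x i}" for x
  have "finite ({..<j} \<rightarrow>\<^sub>E {..n})" by (intro finite_PiE) auto
  then have "finite K" unfolding K_def by (rule rev_finite_subset) auto
  have [measurable]: "cell_count h i \<in> M \<rightarrow>\<^sub>M count_space UNIV" for i
    by (rule cell_count_measurable[OF \<open>0 < h\<close>])
  have F_sets: "F x \<in> events" for x
    unfolding F_def by measurable
  have E_eq: "E = (\<Union>x\<in>K. F x)"
  proof (intro equalityI subsetI)
    fix \<omega> assume "\<omega> \<in> E"
    then have \<omega>: "\<omega> \<in> space M" and B: "B (\<lambda>i\<in>{..<j}. cell_count h i \<omega>)"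
      and n: "(\<Sum>i<j. cell_count h i \<omega>) = n"
      and y: "\<And>i. j \<le> i \<Longrightarrow> i < m \<Longrightarrow> cell_count h i \<omega> = y i"
      using sum_cell_count[OF _ \<open>0 < h\<close>] unfolding E_def by auto
    have "cell_count h i \<omega> \<le> n" if "i < j" for i
      using that unfolding n[symmetric] by (intro member_le_sum) auto
    then have "(\<lambda>i\<in>{..<j}. cell_count h i \<omega>) \<in> K"
      unfolding K_def using n B by auto
    moreover have "\<omega> \<in> F (\<lambda>i\<in>{..<j}. cell_count h i \<omega>)"
      unfolding F_def z_def using \<omega> y by auto
    ultimately show "\<omega> \<in> (\<Union>x\<in>K. F x)" by blast
  next
    fix \<omega> assume "\<omega> \<in> (\<Union>x\<in>K. F x)"
    then obtain x where x: "x \<in> K" and \<omega>: "\<omega> \<in> space M"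
      and *: "\<And>i. i < m \<Longrightarrow> cell_count h i \<omega> = z x i"
      unfolding F_def by auto
    have cx: "cell_count h i \<omega> = x i" if "i < j" for i
      using *[of i] that \<open>j \<le> m\<close> by (simp add: z_def)
    have "(\<lambda>i\<in>{..<j}. cell_count h i \<omega>) = x"
    proof
      fix i show "(\<lambda>i\<in>{..<j}. cell_count h i \<omega>) i = x i"
        using cx[of i] x unfolding K_def by (auto simp: PiE_def extensional_def)
    qed
    moreover have "N (real j * h) \<omega> = n"
    proof -
      have "(\<Sum>i<j. cell_count h i \<omega>) = sum x {..<j}"
        by (intro sum.cong) (auto simp: cx)
      then show ?thesis
        using x sum_cell_count[OF \<omega> \<open>0 < h\<close>, of j] by (simp add: K_def)
    qed
    moreover have "cell_count h i \<omega> = y i" if "j \<le> i" "i < m" for i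
      using *[OF that(2)] that by (simp add: z_def)
    ultimately show "\<omega> \<in> E"
      using \<omega> x unfolding E_def K_def by simp
  qed
  show "E \<in> events"
    unfolding E_eq using \<open>finite K\<close> F_sets by (intro sets.finite_UN) auto
  have disj: "disjoint_family_on F K"
    unfolding disjoint_family_on_def
  proof (intro ballI impI)
    fix x x' assume K: "x \<in> K" "x' \<in> K" and "x \<noteq> x'"
    have "\<exists>i<j. x i \<noteq> x' i"
    proof (rule ccontr)
      assume "\<not> (\<exists>i<j. x i \<noteq> x' i)"
      then have "x i = x' i" if "i \<in> {..<j}" for i using that by simp
      moreover have "x \<in> {..<j} \<rightarrow>\<^sub>E {..n}" "x' \<in> {..<j} \<rightarrow>\<^sub>E {..n}"
        using K by (simp_all add: K_def)
      ultimately have "x = x'" by (intro PiE_ext[of x "{..<j}" "\<lambda>_. {..n}" x'])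
      then show False using \<open>x \<noteq> x'\<close> by simp
    qed
    then obtain i where i: "i < j" "x i \<noteq> x' i" by auto
    then have "z x i \<noteq> z x' i" "i < m" using \<open>j \<le> m\<close> by (auto simp: z_def)
    then show "F x \<inter> F x' = {}" unfolding F_def by auto
  qed
  let ?p = "\<lambda>k. (rate * h) ^ k / fact k * exp (- (rate * h))"
  have "prob (F x) = (\<Prod>i<j. 1 / fact (x i)) * ((rate * h) ^ n * exp (- (rate * h)) ^ j)
      * (\<Prod>i\<in>{j..<m}. ?p (y i))" if "x \<in> K" for x
  proof -
    have "prob (F x) = (\<Prod>i<m. ?p (z x i))"
      unfolding F_def by (rule prob_cell_counts[OF \<open>0 < h\<close>])
    also have "{..<m} = {..<j} \<union> {j..<m}" using \<open>j \<le> m\<close> by auto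
    also have "(\<Prod>i\<in>{..<j} \<union> {j..<m}. ?p (z x i)) = (\<Prod>i<j. ?p (z x i)) * (\<Prod>i\<in>{j..<m}. ?p (z x i))"
      by (intro prod.union_disjoint) auto
    also have "(\<Prod>i\<in>{j..<m}. ?p (z x i)) = (\<Prod>i\<in>{j..<m}. ?p (y i))"
      by (intro prod.cong) (auto simp: z_def)
    also have "(\<Prod>i<j. ?p (z x i)) = (\<Prod>i<j. 1 / fact (x i) * ((rate * h) ^ x i * exp (- (rate * h))))"
      by (intro prod.cong) (auto simp: z_def)
    also have "\<dots> = (\<Prod>i<j. 1 / fact (x i)) * ((rate * h) ^ sum x {..<j} * exp (- (rate * h)) ^ j)"
      by (simp only: prod.distrib power_sum prod_constant card_lessThan)
    also have "sum x {..<j} = n" using that by (simp add: K_def)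
    finally show ?thesis .
  qed
  moreover have "prob E = (\<Sum>x\<in>K. prob (F x))"
    unfolding E_eq using \<open>finite K\<close> F_sets disj by (intro finite_measure_finite_Union) auto
  ultimately show "prob E = (\<Sum>x\<in>{x \<in> {..<j} \<rightarrow>\<^sub>E {..n}. sum x {..<j} = n \<and> B x}. \<Prod>i<j. 1 / fact (x i))
      * ((rate * h) ^ n * exp (- (rate * h)) ^ j)
      * (\<Prod>i\<in>{j..<m}. (rate * h) ^ y i / fact (y i) * exp (- (rate * h)))"
    unfolding K_def[symmetric] by (simp add: sum_distrib_right)
qed

text \<open>Given \<open>n\<close> events in the first \<open>j\<close> cells, the distribution of the counts in these
cells depends neither on the cell width nor on what happens later.  Written without
division, the two sides are the same product of the factors in \<open>prob_past_future\<close>.\<close>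

lemma past_scaling:
  fixes B :: "(nat \<Rightarrow> nat) \<Rightarrow> bool"
  assumes "0 < h" "0 < w" "j \<le> m"
  shows "prob {\<omega> \<in> space M. B (\<lambda>i\<in>{..<j}. cell_count h i \<omega>) \<and> N (real j * h) \<omega> = n
      \<and> (\<forall>i. j \<le> i \<and> i < m \<longrightarrow> cell_count h i \<omega> = y i)}
    * prob {\<omega> \<in> space M. N (real j * w) \<omega> = n}
    = prob {\<omega> \<in> space M. B (\<lambda>i\<in>{..<j}. cell_count w i \<omega>) \<and> N (real j * w) \<omega> = n}
    * prob {\<omega> \<in> space M. N (real j * h) \<omega> = n
      \<and> (\<forall>i. j \<le> i \<and> i < m \<longrightarrow> cell_count h i \<omega> = y i)}"
proof -
  have none: "(\<forall>i. j \<le> i \<and> i < j \<longrightarrow> cell_count w i \<omega> = y i) \<longleftrightarrow> True" for \<omega>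
    by auto
  show ?thesis
    using prob_past_future(2)[OF assms(1,3), of B n y]
      prob_past_future(2)[OF assms(1,3), of "\<lambda>_. True" n y]
      prob_past_future(2)[OF assms(2) order.refl[of j], of B n y]
      prob_past_future(2)[OF assms(2) order.refl[of j], of "\<lambda>_. True" n y]
    unfolding none by simp
qed

lemma prob_cell_count_ge_1:
  assumes "0 < h"
  shows "prob {\<omega> \<in> space M. 1 \<le> cell_count h i \<omega>} \<le> rate * h"
proof -
  have [measurable]: "cell_count h i \<in> M \<rightarrow>\<^sub>M count_space UNIV"
    by (rule cell_count_measurable[OF assms])
  have "{\<omega> \<in> space M. 1 \<le> cell_count h i \<omega>} = space M - {\<omega> \<in> space M. cell_count h i \<omega> = 0}"
    by auto
  moreover have "{\<omega> \<in> space M. cell_count h i \<omega> = 0} \<in> events" by measurable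
  ultimately have "prob {\<omega> \<in> space M. 1 \<le> cell_count h i \<omega>} = 1 - exp (- (rate * h))"
    using prob_compl prob_cell_count_eq[OF assms, of i 0] by simp
  then show ?thesis using exp_ge_add_one_self[of "- (rate * h)"] by simp
qed

lemma prob_cell_count_ge_2:
  assumes "0 < h"
  shows "prob {\<omega> \<in> space M. 2 \<le> cell_count h i \<omega>} \<le> (rate * h)\<^sup>2"
proof -
  have [measurable]: "cell_count h i \<in> M \<rightarrow>\<^sub>M count_space UNIV"
    by (rule cell_count_measurable[OF assms])
  let ?a = "rate * h"
  have "{\<omega> \<in> space M. 2 \<le> cell_count h i \<omega>}
      = space M - ({\<omega> \<in> space M. cell_count h i \<omega> = 0} \<union> {\<omega> \<in> space M. cell_count h i \<omega> = 1})"
    by auto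
  moreover have ev: "{\<omega> \<in> space M. cell_count h i \<omega> = k} \<in> events" for k by measurable
  ultimately have "prob {\<omega> \<in> space M. 2 \<le> cell_count h i \<omega>}
      = 1 - prob ({\<omega> \<in> space M. cell_count h i \<omega> = 0} \<union> {\<omega> \<in> space M. cell_count h i \<omega> = 1})"
    using prob_compl by simp
  also have "prob ({\<omega> \<in> space M. cell_count h i \<omega> = 0} \<union> {\<omega> \<in> space M. cell_count h i \<omega> = 1})
      = exp (- ?a) * (1 + ?a)"
    using prob_cell_count_eq[OF assms, of i 0] prob_cell_count_eq[OF assms, of i 1] ev
    by (subst finite_measure_Union) (auto simp: algebra_simps)
  finally have "prob {\<omega> \<in> space M. 2 \<le> cell_count h i \<omega>} = 1 - exp (- ?a) * (1 + ?a)" .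
  moreover have "(1 - ?a) * (1 + ?a) \<le> exp (- ?a) * (1 + ?a)"
    using exp_ge_add_one_self[of "- ?a"] assms rate_pos by (intro mult_right_mono) auto
  ultimately show ?thesis by (simp add: algebra_simps power2_eq_square)
qed

text \<open>The maximum is the pointwise limit of its grid versions, which are functions of finitely many
counts.  The \<open>\<sigma>\<close>-algebra \<open>W\<close> is a parameter because independence of the initial
velocity calls for measurability with respect to the \<open>\<sigma>\<close>-algebra that the counting process
generates.\<close>

lemma path_max_measurable:
  assumes c: "c1 > 0" "c2 > 0" and "0 < t" and sp: "space W = space M"
    and W: "\<And>s. 0 \<le> s \<Longrightarrow> N s \<in> W \<rightarrow>\<^sub>M count_space UNIV"
  shows "(\<lambda>\<omega>. path_max c1 c2 (\<lambda>s. N s \<omega>) t) \<in> borel_measurable W"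
proof (rule borel_measurable_LIMSEQ_real)
  define u where "u k \<omega> = t / real (Suc k)
    * grid_max c1 c2 (\<lambda>l. N (real l * (t / real (Suc k))) \<omega>) (Suc k)" for k \<omega>
  show "u k \<in> borel_measurable W" for k
  proof -
    have [measurable]: "N (real l * (t / real (Suc k))) \<in> W \<rightarrow>\<^sub>M count_space UNIV" for l
      using \<open>0 < t\<close> by (intro W) simp
    have "(\<lambda>\<omega>. velocity_after c1 c2 (N (real l * (t / real (Suc k))) \<omega>)) \<in> borel_measurable W" for l
      by measurable
    then have "(\<lambda>\<omega>. grid_max c1 c2 (\<lambda>l. N (real l * (t / real (Suc k))) \<omega>) (Suc k)) \<in> borel_measurable W"
      unfolding grid_max_def by (intro borel_measurable_Max borel_measurable_sum) auto
    then show ?thesis unfolding u_def by measurable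
  qed
  fix \<omega> assume "\<omega> \<in> space W"
  then have \<omega>: "\<omega> \<in> space M" using sp by simp
  let ?K = "(c1 + c2) * t * (real (N t \<omega>) + 1)"
  have "(\<lambda>k. ?K * inverse (real (Suc k))) \<longlonglongrightarrow> ?K * 0"
    by (intro tendsto_mult tendsto_const LIMSEQ_inverse_real_of_nat)
  then have null: "(\<lambda>k. ?K * inverse (real (Suc k))) \<longlonglongrightarrow> 0"
    by simp
  have "(\<lambda>k. u k \<omega> - path_max c1 c2 (\<lambda>s. N s \<omega>) t) \<longlonglongrightarrow> 0"
  proof (rule Lim_null_comparison[OF always_eventually null], rule allI)
    fix k
    have "\<bar>path_max c1 c2 (\<lambda>s. N s \<omega>) t - u k \<omega>\<bar> \<le> (c1 + c2) * (t / real (Suc k)) * (real (N t \<omega>) + 1)"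
      unfolding u_def by (rule path_max_grid_max[OF mono_on_path[OF \<omega>] c \<open>0 < t\<close>]) simp
    also have "\<dots> = ?K * inverse (real (Suc k))"
      by (simp only: divide_inverse mult_ac)
    finally show "norm (u k \<omega> - path_max c1 c2 (\<lambda>s. N s \<omega>) t) \<le> ?K * inverse (real (Suc k))"
      by (simp only: real_norm_def abs_minus_commute)
  qed
  then show "(\<lambda>k. u k \<omega>) \<longlonglongrightarrow> path_max c1 c2 (\<lambda>s. N s \<omega>) t"
    by (rule LIM_zero_cancel)
qed

end

section \<open>Removing the last event\<close>

text \<open>On a grid with \<open>J\<^sup>2\<close> cells two events share a cell with probability of order \<open>1 / J\<^sup>2\<close>,
and the first \<open>J\<close> cells contain an event with probability of order \<open>1 / J\<close>.  The square makes
both vanish while \<open>J\<close> tends to infinity; here \<open>a\<close> stands for \<open>rate * t\<close>.\<close>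

lemma transfer_error_tendsto_0:
  fixes a :: real
  shows "(\<lambda>J. real ((Suc J)\<^sup>2) * (a / real ((Suc J)\<^sup>2))\<^sup>2 + real (Suc J) * (a / real ((Suc J)\<^sup>2))) \<longlonglongrightarrow> 0"
proof -
  have "(\<lambda>J. a\<^sup>2 * (inverse (real (Suc J)) * inverse (real (Suc J))) + a * inverse (real (Suc J)))
      \<longlonglongrightarrow> a\<^sup>2 * (0 * 0) + a * 0"
    by (intro tendsto_intros LIMSEQ_inverse_real_of_nat)
  moreover have "real ((Suc J)\<^sup>2) * (a / real ((Suc J)\<^sup>2))\<^sup>2 + real (Suc J) * (a / real ((Suc J)\<^sup>2))
      = a\<^sup>2 * (inverse (real (Suc J)) * inverse (real (Suc J))) + a * inverse (real (Suc J))" for J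
  proof -
    have "x\<^sup>2 * (a / x\<^sup>2)\<^sup>2 + x * (a / x\<^sup>2) = a\<^sup>2 * (inverse x * inverse x) + a * inverse x" if "x \<noteq> 0" for x :: real
      using that by (simp add: power2_eq_square field_simps)
    from this[of "real (Suc J)"] show ?thesis by (simp only: of_nat_power)
  qed
  ultimately show ?thesis by simp
qed

context poisson_process
begin

text \<open>Divide \<open>{0..t}\<close> into \<open>m\<close> cells.  Unless some cell holds two events or the first
\<open>J\<close> cells hold one, the last of the \<open>Suc n\<close> events is the only event of a
cell \<open>j \<ge> J\<close>, the path before it has \<open>n\<close> events in \<open>j\<close> cells, and the
rest of the path descends, so that the maximum is that of the past up to a bounded multiple of the
cell width.
By \<open>past_scaling\<close> the past can be stretched from \<open>j\<close> cells of width
\<open>t / m\<close> to \<open>j\<close> cells of width \<open>t / j\<close>, that is to all of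
\<open>{0..t}\<close>.  Each maximum, measured in units of its own cell width, changes by a bounded amount
only; the hypothesis \<open>trans\<close> asks that \<open>P\<close> on one side
force \<open>Q\<close> on the other within this tolerance.  The positions \<open>j\<close> of the last event are disjoint
cases, so their probabilities add up to at most that of \<open>Suc n\<close> events.\<close>

lemma last_event_transfer:
  fixes P Q :: "real \<Rightarrow> bool" and c1 c2 t :: real and n m J :: nat
  assumes c: "c1 > 0" "c2 > 0" and "0 < t" and "odd n" and J: "0 < J" "J \<le> m"
    and [measurable]: "Measurable.pred borel Q"
    and trans: "\<And>j u v. J \<le> j \<Longrightarrow> j < m \<Longrightarrow> P u \<Longrightarrow>
      \<bar>u * (real m / t) - v * (real j / t)\<bar> \<le> (c1 + c2) * (2 * real n + 4) \<Longrightarrow> Q v"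
  shows "prob {\<omega> \<in> space M. P (path_max c1 c2 (\<lambda>s. N s \<omega>) t) \<and> N t \<omega> = Suc n}
      * prob {\<omega> \<in> space M. N t \<omega> = n}
    \<le> real m * (rate * (t / real m))\<^sup>2 + real J * (rate * (t / real m))
      + prob {\<omega> \<in> space M. Q (path_max c1 c2 (\<lambda>s. N s \<omega>) t) \<and> N t \<omega> = n}
      * prob {\<omega> \<in> space M. N t \<omega> = Suc n}"
proof -
  define h where "h = t / real m"
  have h: "0 < h" and mh: "real m * h = t" and ht: "real m / t = 1 / h" and "0 < m"
    using \<open>0 < t\<close> J by (auto simp: h_def)
  let ?C = "c1 + c2"
  define X where "X \<omega> = path_max c1 c2 (\<lambda>s. N s \<omega>) t" for \<omega>
  \<comment> \<open>\<open>R j\<close> keeps only what the first \<open>j\<close> cells show of \<open>P (X \<omega>)\<close>: the discretisation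
    costs \<open>c1 + c2\<close> cell widths for each of the \<open>n + 1\<close> events and once more, and the step in
    the cell of the last event at most as much again; hence \<open>n + 3\<close>.\<close>
  define R where "R j x \<longleftrightarrow> (\<exists>u. P u \<and> \<bar>u / h - grid_max c1 c2 (\<lambda>l. \<Sum>i<l. x i) j\<bar> \<le> ?C * (real n + 3))"
    for j and x :: "nat \<Rightarrow> nat"
  define tail where "tail j \<omega> \<longleftrightarrow> (\<forall>i. j \<le> i \<and> i < m \<longrightarrow> cell_count h i \<omega> = (if i = j then 1 else 0))"
    for j \<omega>
  define E where "E j = {\<omega> \<in> space M. R j (\<lambda>i\<in>{..<j}. cell_count h i \<omega>) \<and> N (real j * h) \<omega> = n \<and> tail j \<omega>}" for j
  define L where "L j = {\<omega> \<in> space M. N (real j * h) \<omega> = n \<and> tail j \<omega>}" for j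
  define D where "D = (\<Union>i\<in>{..<m}. {\<omega> \<in> space M. 2 \<le> cell_count h i \<omega>})"
  define F where "F = (\<Union>i\<in>{..<J}. {\<omega> \<in> space M. 1 \<le> cell_count h i \<omega>})"
  have [measurable]: "cell_count h i \<in> M \<rightarrow>\<^sub>M count_space UNIV" for i
    by (rule cell_count_measurable[OF h])
  have [measurable]: "N t \<in> M \<rightarrow>\<^sub>M count_space UNIV"
    using \<open>0 < t\<close> by (intro N_measurable) simp
  have [measurable]: "X \<in> borel_measurable M"
    unfolding X_def by (rule path_max_measurable[OF c \<open>0 < t\<close> refl N_measurable])
  have cell_ev: "{\<omega> \<in> space M. k \<le> cell_count h i \<omega>} \<in> events" for k i
    by measurable
  have E_ev: "E j \<in> events" if "j \<le> m" for j
    unfolding E_def tail_def by (rule prob_past_future(1)[OF h that])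
  have L_ev: "L j \<in> events" if "j \<le> m" for j
    using prob_past_future(1)[OF h that, of "\<lambda>_. True"] unfolding L_def tail_def by simp
  have D_ev: "D \<in> events" and F_ev: "F \<in> events"
    unfolding D_def F_def using cell_ev by (auto intro!: sets.finite_UN)
  have grid_cells: "grid_max c1 c2 (\<lambda>l. \<Sum>i<l. (\<lambda>i\<in>{..<j}. cell_count w i \<omega>) i) j
      = grid_max c1 c2 (\<lambda>l. N (real l * w) \<omega>) j" if "\<omega> \<in> space M" "0 < w" for j w \<omega>
  proof (rule grid_max_cong)
    fix l assume "l < j"
    then have "(\<Sum>i<l. (\<lambda>i\<in>{..<j}. cell_count w i \<omega>) i) = (\<Sum>i<l. cell_count w i \<omega>)"
      by (intro sum.cong) auto
    then show "(\<Sum>i<l. (\<lambda>i\<in>{..<j}. cell_count w i \<omega>) i) = N (real l * w) \<omega>"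
      using sum_cell_count[OF that] by simp
  qed

  have cover: "{\<omega> \<in> space M. P (X \<omega>) \<and> N t \<omega> = Suc n} \<subseteq> (D \<union> F) \<union> (\<Union>j\<in>{J..<m}. E j)"
  proof
    fix \<omega> assume "\<omega> \<in> {\<omega> \<in> space M. P (X \<omega>) \<and> N t \<omega> = Suc n}"
    then have \<omega>: "\<omega> \<in> space M" and P: "P (X \<omega>)" and Nt: "N t \<omega> = Suc n" by auto
    define y where "y l = N (real l * h) \<omega>" for l
    show "\<omega> \<in> (D \<union> F) \<union> (\<Union>j\<in>{J..<m}. E j)"
    proof (cases "\<omega> \<in> D")
      case False
      have "mono y"
        unfolding y_def using h \<omega> by (auto intro!: monoI N_mono mult_right_mono)
      moreover have "y 0 = 0" unfolding y_def using N_zero \<omega> by simp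
      moreover have "y m = Suc n" unfolding y_def mh by (rule Nt)
      moreover have "y (Suc i) - y i < 2" if "i < m" for i
      proof -
        have "\<not> 2 \<le> cell_count h i \<omega>" using False \<omega> that unfolding D_def by blast
        then show ?thesis unfolding y_def cell_count_def by linarith
      qed
      ultimately obtain j where j: "j < m" "y j = n"
        and after: "\<And>l. j < l \<Longrightarrow> l \<le> m \<Longrightarrow> y l = Suc n"
        using last_event_cell[of y m n] by blast
      have cell_y: "cell_count h i \<omega> = y (Suc i) - y i" for i
        unfolding cell_count_def y_def ..
      have tail: "tail j \<omega>"
        unfolding tail_def cell_y
      proof (intro allI impI)
        fix i assume i: "j \<le> i \<and> i < m"
        then have "y (Suc i) = Suc n" by (intro after) auto
        moreover have "y i = (if i = j then n else Suc n)"
          using i j after[of i] by auto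
        ultimately show "y (Suc i) - y i = (if i = j then 1 else 0)" by simp
      qed
      show ?thesis
      proof (cases "j < J")
        case True
        have "cell_count h j \<omega> = 1" using tail \<open>j < m\<close> unfolding tail_def by simp
        then have "1 \<le> cell_count h j \<omega>" by simp
        then have "\<omega> \<in> F" unfolding F_def using \<omega> True by blast
        then show ?thesis by simp
      next
        case False
        have "even (y l)" if "j < l" "l < m" for l
          using after[of l] that \<open>odd n\<close> by simp
        then have near: "grid_max c1 c2 y j \<le> grid_max c1 c2 y m"
            "grid_max c1 c2 y m \<le> grid_max c1 c2 y j + c1"
          using grid_max_last_event[OF c \<open>j < m\<close>, of y] j(2) \<open>odd n\<close> by auto
        have "\<bar>X \<omega> - h * grid_max c1 c2 y m\<bar> \<le> ?C * h * (real (Suc n) + 1)"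
          using path_max_grid_max[OF mono_on_path[OF \<omega>] c \<open>0 < t\<close> \<open>0 < m\<close>]
          unfolding X_def y_def h_def Nt .
        then have "\<bar>X \<omega> / h - grid_max c1 c2 y m\<bar> \<le> ?C * (real n + 2)"
          using h by (simp add: abs_le_iff field_simps)
        then have "\<bar>X \<omega> / h - grid_max c1 c2 y j\<bar> \<le> ?C * (real n + 3)"
          using near c by (simp add: abs_le_iff algebra_simps)
        then have "R j (\<lambda>i\<in>{..<j}. cell_count h i \<omega>)"
          unfolding R_def grid_cells[OF \<omega> h] y_def[symmetric] using P by blast
        then have "\<omega> \<in> E j"
          unfolding E_def using \<omega> tail j(2) unfolding y_def by simp
        then show ?thesis using False \<open>j < m\<close> by auto
      qed
    qed simp
  qed

  have pasts: "prob (E j) * prob {\<omega> \<in> space M. N t \<omega> = n}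
      \<le> prob {\<omega> \<in> space M. Q (X \<omega>) \<and> N t \<omega> = n} * prob (L j)" if "j \<in> {J..<m}" for j
  proof -
    define w where "w = t / real j"
    have j: "J \<le> j" "j < m" "0 < j" using that J by auto
    then have w: "0 < w" and jw: "real j * w = t" and wt: "real j / t = 1 / w"
      using \<open>0 < t\<close> by (auto simp: w_def)
    have "{\<omega> \<in> space M. R j (\<lambda>i\<in>{..<j}. cell_count w i \<omega>) \<and> N t \<omega> = n}
        \<subseteq> {\<omega> \<in> space M. Q (X \<omega>) \<and> N t \<omega> = n}"
    proof
      fix \<omega> assume "\<omega> \<in> {\<omega> \<in> space M. R j (\<lambda>i\<in>{..<j}. cell_count w i \<omega>) \<and> N t \<omega> = n}"
      then have \<omega>: "\<omega> \<in> space M" and R: "R j (\<lambda>i\<in>{..<j}. cell_count w i \<omega>)" and n: "N t \<omega> = n"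
        by auto
      let ?G = "grid_max c1 c2 (\<lambda>l. N (real l * w) \<omega>) j"
      obtain u where u: "P u" "\<bar>u / h - ?G\<bar> \<le> ?C * (real n + 3)"
        using R unfolding R_def grid_cells[OF \<omega> w] by blast
      have "\<bar>X \<omega> - w * ?G\<bar> \<le> ?C * w * (real n + 1)"
        using path_max_grid_max[OF mono_on_path[OF \<omega>] c \<open>0 < t\<close> \<open>0 < j\<close>]
        unfolding X_def w_def n .
      then have "\<bar>X \<omega> / w - ?G\<bar> \<le> ?C * (real n + 1)"
        using w by (simp add: abs_le_iff field_simps)
      then have "\<bar>u / h - X \<omega> / w\<bar> \<le> ?C * (2 * real n + 4)"
        using u(2) by (simp add: abs_le_iff algebra_simps)
      then have "Q (X \<omega>)"
        using trans[OF j(1,2) u(1), of "X \<omega>"] unfolding ht wt by simp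
      then show "\<omega> \<in> {\<omega> \<in> space M. Q (X \<omega>) \<and> N t \<omega> = n}"
        using \<omega> n by simp
    qed
    then have "prob {\<omega> \<in> space M. R j (\<lambda>i\<in>{..<j}. cell_count w i \<omega>) \<and> N t \<omega> = n}
        \<le> prob {\<omega> \<in> space M. Q (X \<omega>) \<and> N t \<omega> = n}"
      by (intro finite_measure_mono) measurable
    moreover have "prob (E j) * prob {\<omega> \<in> space M. N t \<omega> = n}
        = prob {\<omega> \<in> space M. R j (\<lambda>i\<in>{..<j}. cell_count w i \<omega>) \<and> N t \<omega> = n} * prob (L j)"
      using past_scaling[OF h w, of j m "R j" n "\<lambda>i. if i = j then 1 else 0"] j
      unfolding E_def L_def tail_def jw by simp
    ultimately show ?thesis by (simp add: mult_right_mono)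
  qed

  have "disjoint_family_on L {J..<m}"
    unfolding disjoint_family_on_def
  proof (intro ballI impI)
    have "L i \<inter> L j = {}" if "i < j" "j < m" for i j
      using that unfolding L_def tail_def by (auto dest!: spec[of _ j])
    then show "L i \<inter> L j = {}" if "i \<in> {J..<m}" "j \<in> {J..<m}" "i \<noteq> j" for i j
      using that by (cases i j rule: linorder_cases) auto
  qed
  then have "(\<Sum>j\<in>{J..<m}. prob (L j)) = prob (\<Union>j\<in>{J..<m}. L j)"
    using L_ev by (intro finite_measure_finite_Union[symmetric]) auto
  also have "\<dots> \<le> prob {\<omega> \<in> space M. N t \<omega> = Suc n}"
  proof (rule finite_measure_mono)
    show "(\<Union>j\<in>{J..<m}. L j) \<subseteq> {\<omega> \<in> space M. N t \<omega> = Suc n}"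
    proof clarify
      fix \<omega> j assume j: "j \<in> {J..<m}" and "\<omega> \<in> L j"
      then have \<omega>: "\<omega> \<in> space M" and Nj: "N (real j * h) \<omega> = n" and tl: "tail j \<omega>"
        unfolding L_def by auto
      have "N t \<omega> = (\<Sum>i<m. cell_count h i \<omega>)"
        using sum_cell_count[OF \<omega> h, of m] mh by simp
      also have "{..<m} = {..<j} \<union> {j..<m}" using j by auto
      also have "(\<Sum>i\<in>{..<j} \<union> {j..<m}. cell_count h i \<omega>)
          = (\<Sum>i<j. cell_count h i \<omega>) + (\<Sum>i\<in>{j..<m}. cell_count h i \<omega>)"
        by (intro sum.union_disjoint) auto
      also have "(\<Sum>i\<in>{j..<m}. cell_count h i \<omega>) = (\<Sum>i\<in>{j..<m}. if i = j then 1 else 0)"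
        using tl unfolding tail_def by (intro sum.cong) auto
      also have "\<dots> = 1" using j by simp
      also have "(\<Sum>i<j. cell_count h i \<omega>) = n"
        using sum_cell_count[OF \<omega> h, of j] Nj by simp
      finally show "\<omega> \<in> space M \<and> N t \<omega> = Suc n" using \<omega> by simp
    qed
  qed measurable
  finally have L_sum: "(\<Sum>j\<in>{J..<m}. prob (L j)) \<le> prob {\<omega> \<in> space M. N t \<omega> = Suc n}" .

  have "prob D \<le> (\<Sum>i<m. prob {\<omega> \<in> space M. 2 \<le> cell_count h i \<omega>})"
    unfolding D_def using cell_ev by (intro finite_measure_subadditive_finite) auto
  also have "\<dots> \<le> (\<Sum>i<m. (rate * h)\<^sup>2)"
    by (intro sum_mono prob_cell_count_ge_2[OF h])
  finally have D: "prob D \<le> real m * (rate * h)\<^sup>2" by simp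
  have "prob F \<le> (\<Sum>i<J. prob {\<omega> \<in> space M. 1 \<le> cell_count h i \<omega>})"
    unfolding F_def using cell_ev by (intro finite_measure_subadditive_finite) auto
  also have "\<dots> \<le> (\<Sum>i<J. rate * h)"
    by (intro sum_mono prob_cell_count_ge_1[OF h])
  finally have F: "prob F \<le> real J * (rate * h)" by simp

  let ?pn = "prob {\<omega> \<in> space M. N t \<omega> = n}"
  let ?q = "prob {\<omega> \<in> space M. Q (X \<omega>) \<and> N t \<omega> = n}"
  have UE: "(\<Union>j\<in>{J..<m}. E j) \<in> events" using E_ev by auto
  have "prob {\<omega> \<in> space M. P (X \<omega>) \<and> N t \<omega> = Suc n} \<le> prob ((D \<union> F) \<union> (\<Union>j\<in>{J..<m}. E j))"
    using cover D_ev F_ev UE by (intro finite_measure_mono) auto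
  also have "\<dots> \<le> prob (D \<union> F) + prob (\<Union>j\<in>{J..<m}. E j)"
    using D_ev F_ev UE by (intro measure_Un_le) auto
  also have "prob (D \<union> F) \<le> prob D + prob F"
    using D_ev F_ev by (rule measure_Un_le)
  also have "prob (\<Union>j\<in>{J..<m}. E j) \<le> (\<Sum>j\<in>{J..<m}. prob (E j))"
    using E_ev by (intro finite_measure_subadditive_finite) auto
  finally have "prob {\<omega> \<in> space M. P (X \<omega>) \<and> N t \<omega> = Suc n}
      \<le> (prob D + prob F) + (\<Sum>j\<in>{J..<m}. prob (E j))" by simp
  then have "prob {\<omega> \<in> space M. P (X \<omega>) \<and> N t \<omega> = Suc n} * ?pn
      \<le> ((prob D + prob F) + (\<Sum>j\<in>{J..<m}. prob (E j))) * ?pn"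
    by (intro mult_right_mono) auto
  also have "\<dots> = (prob D + prob F) * ?pn + (\<Sum>j\<in>{J..<m}. prob (E j) * ?pn)"
    by (simp add: distrib_right sum_distrib_right)
  also have "(prob D + prob F) * ?pn \<le> (prob D + prob F) * 1"
    by (intro mult_left_mono) auto
  also have "(\<Sum>j\<in>{J..<m}. prob (E j) * ?pn) \<le> (\<Sum>j\<in>{J..<m}. ?q * prob (L j))"
    by (intro sum_mono pasts)
  also have "\<dots> \<le> ?q * prob {\<omega> \<in> space M. N t \<omega> = Suc n}"
    unfolding sum_distrib_left[symmetric] by (intro mult_left_mono L_sum) auto
  finally show ?thesis
    using D F unfolding X_def h_def[symmetric] by simp
qed

text \<open>A maximum above \<open>\<epsilon>\<close> leaves a positive maximum for the stretched past
once the cells are fine enough: in units of the cell width, which stretching preserves up to the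
tolerance, the maximum exceeds \<open>\<epsilon> * m / t\<close>, while the tolerance does not grow with \<open>m\<close>.
Then \<open>\<epsilon>\<close> tends to 0.\<close>

lemma prob_path_max_gt_le:
  fixes c1 c2 t :: real and n :: nat
  assumes c: "c1 > 0" "c2 > 0" and "0 < t" and "odd n"
  shows "prob {\<omega> \<in> space M. path_max c1 c2 (\<lambda>s. N s \<omega>) t > 0 \<and> N t \<omega> = Suc n}
      * prob {\<omega> \<in> space M. N t \<omega> = n}
    \<le> prob {\<omega> \<in> space M. path_max c1 c2 (\<lambda>s. N s \<omega>) t > 0 \<and> N t \<omega> = n}
      * prob {\<omega> \<in> space M. N t \<omega> = Suc n}" (is "_ * ?pn \<le> ?r")
proof -
  define X where "X \<omega> = path_max c1 c2 (\<lambda>s. N s \<omega>) t" for \<omega>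
  have [measurable]: "X \<in> borel_measurable M"
    unfolding X_def by (rule path_max_measurable[OF c \<open>0 < t\<close> refl N_measurable])
  have [measurable]: "N t \<in> M \<rightarrow>\<^sub>M count_space UNIV"
    using \<open>0 < t\<close> by (intro N_measurable) simp
  let ?err = "\<lambda>J. real ((Suc J)\<^sup>2) * (rate * t / real ((Suc J)\<^sup>2))\<^sup>2
    + real (Suc J) * (rate * t / real ((Suc J)\<^sup>2))"
  have pos: "prob {\<omega> \<in> space M. X \<omega> > \<epsilon> \<and> N t \<omega> = Suc n} * ?pn \<le> ?r" if "\<epsilon> > 0" for \<epsilon>
  proof (rule LIMSEQ_le_const)
    show "(\<lambda>J. ?err J + ?r) \<longlonglongrightarrow> ?r"
      using tendsto_add[OF transfer_error_tendsto_0 tendsto_const[of ?r]] by simp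
    obtain J0 :: nat where J0: "real J0 > (c1 + c2) * (2 * real n + 4) * t / \<epsilon>"
      using reals_Archimedean2 by blast
    have "prob {\<omega> \<in> space M. X \<omega> > \<epsilon> \<and> N t \<omega> = Suc n} * ?pn \<le> ?err J + ?r" if "J0 \<le> J" for J
    proof -
      have "(c1 + c2) * (2 * real n + 4) * t < \<epsilon> * real J0"
        using J0 \<open>\<epsilon> > 0\<close> by (simp add: field_simps)
      also have "\<dots> \<le> \<epsilon> * real ((Suc J)\<^sup>2)"
      proof -
        have "J0 \<le> (Suc J)\<^sup>2" using \<open>J0 \<le> J\<close> by (simp add: power2_eq_square)
        then show ?thesis using \<open>\<epsilon> > 0\<close> by (intro mult_left_mono) (simp_all del: of_nat_power)
      qed
      finally have big: "(c1 + c2) * (2 * real n + 4) < \<epsilon> * (real ((Suc J)\<^sup>2) / t)"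
        using \<open>0 < t\<close> by (simp add: field_simps del: of_nat_power)
      have "prob {\<omega> \<in> space M. X \<omega> > \<epsilon> \<and> N t \<omega> = Suc n} * ?pn
          \<le> real ((Suc J)\<^sup>2) * (rate * (t / real ((Suc J)\<^sup>2)))\<^sup>2
            + real (Suc J) * (rate * (t / real ((Suc J)\<^sup>2))) + ?r"
        unfolding X_def
      proof (rule last_event_transfer[OF c \<open>0 < t\<close> \<open>odd n\<close>])
        show "0 < Suc J" "Suc J \<le> (Suc J)\<^sup>2" by (simp_all add: power2_eq_square)
        show "Measurable.pred borel (\<lambda>u::real. 0 < u)"
          by measurable
        fix j u v assume uv: "\<epsilon> < u"
          "\<bar>u * (real ((Suc J)\<^sup>2) / t) - v * (real j / t)\<bar> \<le> (c1 + c2) * (2 * real n + 4)"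
        have "\<epsilon> * (real ((Suc J)\<^sup>2) / t) \<le> u * (real ((Suc J)\<^sup>2) / t)"
          using uv(1) \<open>0 < t\<close> by (intro mult_right_mono) auto
        with uv(2) big have "0 < v * (real j / t)" by linarith
        then show "0 < v"
          using \<open>0 < t\<close> by (auto simp: zero_less_mult_iff zero_less_divide_iff)
      qed
      then show ?thesis by simp
    qed
    then show "\<exists>k. \<forall>J\<ge>k. prob {\<omega> \<in> space M. X \<omega> > \<epsilon> \<and> N t \<omega> = Suc n} * ?pn \<le> ?err J + ?r"
      by blast
  qed
  have union: "(\<Union>k. {\<omega> \<in> space M. X \<omega> > inverse (real (Suc k)) \<and> N t \<omega> = Suc n})
      = {\<omega> \<in> space M. X \<omega> > 0 \<and> N t \<omega> = Suc n}"
    using reals_Archimedean by (auto intro: less_trans[rotated])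
  have "(\<lambda>k. prob {\<omega> \<in> space M. X \<omega> > inverse (real (Suc k)) \<and> N t \<omega> = Suc n}) \<longlonglongrightarrow>
      prob (\<Union>k. {\<omega> \<in> space M. X \<omega> > inverse (real (Suc k)) \<and> N t \<omega> = Suc n})"
  proof (rule finite_Lim_measure_incseq)
    have "{\<omega> \<in> space M. X \<omega> > inverse (real (Suc k)) \<and> N t \<omega> = Suc n} \<in> events" for k
      by measurable
    then show "range (\<lambda>k. {\<omega> \<in> space M. X \<omega> > inverse (real (Suc k)) \<and> N t \<omega> = Suc n}) \<subseteq> events"
      by blast
    show "incseq (\<lambda>k. {\<omega> \<in> space M. X \<omega> > inverse (real (Suc k)) \<and> N t \<omega> = Suc n})"
    proof (rule monoI, clarify)
      fix k l :: nat and \<omega> assume "k \<le> l" "inverse (real (Suc k)) < X \<omega>"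
      moreover have "inverse (real (Suc l)) \<le> inverse (real (Suc k))"
        using \<open>k \<le> l\<close> by (intro le_imp_inverse_le) auto
      ultimately show "inverse (real (Suc l)) < X \<omega>" by linarith
    qed
  qed
  then have "(\<lambda>k. prob {\<omega> \<in> space M. X \<omega> > inverse (real (Suc k)) \<and> N t \<omega> = Suc n} * ?pn) \<longlonglongrightarrow>
      prob {\<omega> \<in> space M. X \<omega> > 0 \<and> N t \<omega> = Suc n} * ?pn"
    unfolding union by (intro tendsto_mult tendsto_const)
  then show ?thesis
    unfolding X_def[symmetric]
  proof (rule LIMSEQ_le_const2)
    show "\<exists>k0. \<forall>k\<ge>k0. prob {\<omega> \<in> space M. X \<omega> > inverse (real (Suc k)) \<and> N t \<omega> = Suc n} * ?pn
        \<le> prob {\<omega> \<in> space M. X \<omega> > 0 \<and> N t \<omega> = n} * prob {\<omega> \<in> space M. N t \<omega> = Suc n}"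
      using pos unfolding X_def by simp
  qed
qed

text \<open>For a past of \<open>j\<close> cells the tolerance amounts to a height of order \<open>t / j\<close>
after stretching.  This is where the truncation at \<open>J\<close> is needed: it gives a bound of order \<open>1 / J\<close>
uniformly in \<open>j\<close>, and continuity from above of the probability removes it as \<open>J\<close> grows.\<close>

lemma prob_path_max_le_le:
  fixes c1 c2 t :: real and n :: nat
  assumes c: "c1 > 0" "c2 > 0" and "0 < t" and "odd n"
  shows "prob {\<omega> \<in> space M. path_max c1 c2 (\<lambda>s. N s \<omega>) t \<le> 0 \<and> N t \<omega> = Suc n}
      * prob {\<omega> \<in> space M. N t \<omega> = n}
    \<le> prob {\<omega> \<in> space M. path_max c1 c2 (\<lambda>s. N s \<omega>) t \<le> 0 \<and> N t \<omega> = n}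
      * prob {\<omega> \<in> space M. N t \<omega> = Suc n}" (is "?l * ?pn \<le> _ * ?ps")
proof -
  define X where "X \<omega> = path_max c1 c2 (\<lambda>s. N s \<omega>) t" for \<omega>
  have [measurable]: "X \<in> borel_measurable M"
    unfolding X_def by (rule path_max_measurable[OF c \<open>0 < t\<close> refl N_measurable])
  have [measurable]: "N t \<in> M \<rightarrow>\<^sub>M count_space UNIV"
    using \<open>0 < t\<close> by (intro N_measurable) simp
  define K where "K = (c1 + c2) * (2 * real n + 4) * t"
  have "0 < K" unfolding K_def using c \<open>0 < t\<close> by (intro mult_pos_pos) auto
  define S where "S J = {\<omega> \<in> space M. X \<omega> \<le> K * inverse (real (Suc J)) \<and> N t \<omega> = n}" for J
  let ?err = "\<lambda>J. real ((Suc J)\<^sup>2) * (rate * t / real ((Suc J)\<^sup>2))\<^sup>2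
    + real (Suc J) * (rate * t / real ((Suc J)\<^sup>2))"
  have null: "(\<lambda>J. K * inverse (real (Suc J))) \<longlonglongrightarrow> 0"
    using tendsto_mult[OF tendsto_const[of K] LIMSEQ_inverse_real_of_nat] by simp
  have "(\<Inter>J. S J) = {\<omega> \<in> space M. X \<omega> \<le> 0 \<and> N t \<omega> = n}"
  proof (intro equalityI subsetI)
    fix \<omega> assume "\<omega> \<in> (\<Inter>J. S J)"
    then have "\<omega> \<in> space M" "N t \<omega> = n" and *: "\<And>J. X \<omega> \<le> K * inverse (real (Suc J))"
      unfolding S_def by auto
    moreover have "X \<omega> \<le> 0" using * by (intro LIMSEQ_le_const[OF null]) auto
    ultimately show "\<omega> \<in> {\<omega> \<in> space M. X \<omega> \<le> 0 \<and> N t \<omega> = n}" by simp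
  next
    fix \<omega> assume \<omega>: "\<omega> \<in> {\<omega> \<in> space M. X \<omega> \<le> 0 \<and> N t \<omega> = n}"
    have "0 \<le> K * inverse (real (Suc J))" for J using \<open>0 < K\<close> by simp
    with \<omega> show "\<omega> \<in> (\<Inter>J. S J)" unfolding S_def by (auto intro: order_trans)
  qed
  moreover have "(\<lambda>J. prob (S J)) \<longlonglongrightarrow> prob (\<Inter>J. S J)"
  proof (rule finite_Lim_measure_decseq)
    have "S J \<in> events" for J unfolding S_def by measurable
    then show "range S \<subseteq> events" by blast
    show "decseq S"
    proof (intro decseq_SucI subsetI)
      fix k \<omega> assume "\<omega> \<in> S (Suc k)"
      moreover have "K * inverse (real (Suc (Suc k))) \<le> K * inverse (real (Suc k))"
        using \<open>0 < K\<close> by (intro mult_left_mono le_imp_inverse_le) auto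
      ultimately show "\<omega> \<in> S k" unfolding S_def by auto
    qed
  qed
  ultimately have "(\<lambda>J. ?err J + prob (S J) * ?ps) \<longlonglongrightarrow>
      0 + prob {\<omega> \<in> space M. X \<omega> \<le> 0 \<and> N t \<omega> = n} * ?ps"
    by (intro tendsto_add transfer_error_tendsto_0 tendsto_mult tendsto_const) simp
  moreover have "?l * ?pn \<le> ?err J + prob (S J) * ?ps" for J
  proof -
    have "?l * ?pn \<le> real ((Suc J)\<^sup>2) * (rate * (t / real ((Suc J)\<^sup>2)))\<^sup>2
          + real (Suc J) * (rate * (t / real ((Suc J)\<^sup>2))) + prob (S J) * ?ps"
      unfolding S_def X_def
    proof (rule last_event_transfer[OF c \<open>0 < t\<close> \<open>odd n\<close>])
      show "0 < Suc J" "Suc J \<le> (Suc J)\<^sup>2" by (simp_all add: power2_eq_square)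
      show "Measurable.pred borel (\<lambda>u::real. u \<le> K * inverse (real (Suc J)))"
        by measurable
      fix j u v assume j: "Suc J \<le> j" and uv: "u \<le> 0"
        "\<bar>u * (real ((Suc J)\<^sup>2) / t) - v * (real j / t)\<bar> \<le> (c1 + c2) * (2 * real n + 4)"
      have "u * (real ((Suc J)\<^sup>2) / t) \<le> 0"
        using uv(1) \<open>0 < t\<close> by (intro mult_nonpos_nonneg) auto
      with uv(2) have "v * (real j / t) \<le> (c1 + c2) * (2 * real n + 4)" by linarith
      then have "v * real j \<le> K"
        using \<open>0 < t\<close> unfolding K_def by (simp add: field_simps)
      then have "v \<le> K * inverse (real j)"
        using j by (simp add: field_simps)
      also have "\<dots> \<le> K * inverse (real (Suc J))"
        using j \<open>0 < K\<close> by (intro mult_left_mono le_imp_inverse_le) auto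
      finally show "v \<le> K * inverse (real (Suc J))" .
    qed
    then show ?thesis by simp
  qed
  ultimately have "?l * ?pn \<le> 0 + prob {\<omega> \<in> space M. X \<omega> \<le> 0 \<and> N t \<omega> = n} * ?ps"
    by (intro LIMSEQ_le_const) auto
  then show ?thesis unfolding X_def by simp
qed

text \<open>The left-hand sides of the two preceding inequalities have the same sum as the right-hand sides,
since a maximum is either positive or not; so neither inequality can be strict.\<close>

lemma prob_path_max_nonpos_balance:
  fixes c1 c2 t :: real and n :: nat
  assumes c: "c1 > 0" "c2 > 0" and "0 < t" and "odd n"
  shows "prob {\<omega> \<in> space M. path_max c1 c2 (\<lambda>s. N s \<omega>) t \<le> 0 \<and> N t \<omega> = Suc n}
      * prob {\<omega> \<in> space M. N t \<omega> = n}
    = prob {\<omega> \<in> space M. path_max c1 c2 (\<lambda>s. N s \<omega>) t \<le> 0 \<and> N t \<omega> = n}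
      * prob {\<omega> \<in> space M. N t \<omega> = Suc n}"
proof -
  define X where "X \<omega> = path_max c1 c2 (\<lambda>s. N s \<omega>) t" for \<omega>
  have [measurable]: "X \<in> borel_measurable M"
    unfolding X_def by (rule path_max_measurable[OF c \<open>0 < t\<close> refl N_measurable])
  have [measurable]: "N t \<in> M \<rightarrow>\<^sub>M count_space UNIV"
    using \<open>0 < t\<close> by (intro N_measurable) simp
  have split: "prob {\<omega> \<in> space M. N t \<omega> = k}
      = prob {\<omega> \<in> space M. X \<omega> \<le> 0 \<and> N t \<omega> = k} + prob {\<omega> \<in> space M. X \<omega> > 0 \<and> N t \<omega> = k}" for k
  proof -
    have "{\<omega> \<in> space M. N t \<omega> = k}
      = {\<omega> \<in> space M. X \<omega> \<le> 0 \<and> N t \<omega> = k} \<union> {\<omega> \<in> space M. X \<omega> > 0 \<and> N t \<omega> = k}"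
      by auto
    also have "prob \<dots> = prob {\<omega> \<in> space M. X \<omega> \<le> 0 \<and> N t \<omega> = k}
        + prob {\<omega> \<in> space M. X \<omega> > 0 \<and> N t \<omega> = k}"
      by (intro finite_measure_Union) (measurable, auto)
    finally show ?thesis .
  qed
  show ?thesis
    using prob_path_max_gt_le[OF assms] prob_path_max_le_le[OF assms]
    unfolding X_def[symmetric] split[of n] split[of "Suc n"] by (simp add: algebra_simps)
qed

lemma prob_count_pos:
  assumes "0 < t"
  shows "0 < prob {\<omega> \<in> space M. N t \<omega> = n}"
proof -
  have "{\<omega> \<in> space M. cell_count t 0 \<omega> = n} = {\<omega> \<in> space M. N t \<omega> = n}"
    unfolding cell_count_def using N_zero by auto
  then show ?thesis
    using prob_cell_count_eq[OF assms, of 0 n] rate_pos assms by simp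
qed

end

section \<open>Conditioning on the initial velocity\<close>

context telegraph_process
begin

lemma telegraph_max_eq_path_max:
  assumes "V0 \<omega> = - c2"
  shows "telegraph_max c1 c2 V0 N t \<omega> = path_max c1 c2 (\<lambda>s. N s \<omega>) t"
proof -
  have "telegraph_velocity c1 c2 V0 N s \<omega> = velocity_after c1 c2 (N s \<omega>)" for s
    using assms c1_pos c2_pos by (simp add: telegraph_velocity_def velocity_after_def)
  then show ?thesis
    unfolding telegraph_max_def telegraph_position_def path_max_def by simp
qed

text \<open>The initial velocity is independent of the event about the path, so it contributes the factor
\<open>1 / 2\<close> to numerator and denominator alike.\<close>

lemma cond_prob_start_down:
  assumes "0 < t"
  shows "\<P>(\<omega> in M. telegraph_max c1 c2 V0 N t \<omega> = 0
      \<bar> telegraph_velocity c1 c2 V0 N 0 \<omega> = - c2 \<and> N t \<omega> = n)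
    = prob {\<omega> \<in> space M. path_max c1 c2 (\<lambda>s. N s \<omega>) t \<le> 0 \<and> N t \<omega> = n}
      / prob {\<omega> \<in> space M. N t \<omega> = n}"
proof -
  define W where "W = vimage_algebra (space M) (\<lambda>\<omega>. \<lambda>s\<in>{0..}. N s \<omega>) (Pi\<^sub>M {0..} (\<lambda>_. count_space (UNIV :: nat set)))"
  define X where "X \<omega> = path_max c1 c2 (\<lambda>s. N s \<omega>) t" for \<omega>
  have sp: "space W = space M" unfolding W_def by simp
  have path: "(\<lambda>\<omega>. \<lambda>s\<in>{0..}. N s \<omega>) \<in> W \<rightarrow>\<^sub>M Pi\<^sub>M {0..} (\<lambda>_. count_space UNIV)"
    unfolding W_def by (rule measurable_vimage_algebra1) (auto simp: space_PiM)
  have N_W: "N s \<in> W \<rightarrow>\<^sub>M count_space UNIV" if "0 \<le> s" for s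
    using measurable_compose[OF path measurable_component_singleton[of s "{0..}"]] that by simp
  have [measurable]: "X \<in> borel_measurable W" "N t \<in> W \<rightarrow>\<^sub>M count_space UNIV"
    unfolding X_def using assms c1_pos c2_pos by (auto intro!: path_max_measurable N_W sp)
  have half: "prob ({\<omega> \<in> space M. V0 \<omega> = - c2} \<inter> A) = 1 / 2 * prob A" if "A \<in> sets W" for A
  proof -
    have "V0 -` {- c2} \<inter> space M \<in> sets (vimage_algebra (space M) V0 borel)"
      by (rule in_vimage_algebra) simp
    moreover have "V0 -` {- c2} \<inter> space M = {\<omega> \<in> space M. V0 \<omega> = - c2}" by auto
    ultimately show ?thesis
      using indep_setD[OF V0_indep _ that[unfolded W_def]] V0_c2 by simp
  qed
  have "{\<omega> \<in> space W. X \<omega> \<le> 0 \<and> N t \<omega> = n} \<in> sets W" "{\<omega> \<in> space W. N t \<omega> = n} \<in> sets W"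
    by measurable
  note halves = half[OF this(1)] half[OF this(2)]
  have start: "telegraph_velocity c1 c2 V0 N 0 \<omega> = - c2 \<longleftrightarrow> V0 \<omega> = - c2" if "\<omega> \<in> space M" for \<omega>
    using N_zero[OF that] by (simp add: telegraph_velocity_def)
  have "0 \<le> X \<omega>" if "\<omega> \<in> space M" for \<omega>
    unfolding X_def using mono_on_path[OF that] c1_pos c2_pos assms by (intro path_max_nonneg) auto
  then have "{\<omega> \<in> space M. telegraph_max c1 c2 V0 N t \<omega> = 0
        \<and> telegraph_velocity c1 c2 V0 N 0 \<omega> = - c2 \<and> N t \<omega> = n}
      = {\<omega> \<in> space M. V0 \<omega> = - c2} \<inter> {\<omega> \<in> space W. X \<omega> \<le> 0 \<and> N t \<omega> = n}"
    using start telegraph_max_eq_path_max unfolding sp X_def by (auto intro: antisym)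
  moreover have "{\<omega> \<in> space M. telegraph_velocity c1 c2 V0 N 0 \<omega> = - c2 \<and> N t \<omega> = n}
      = {\<omega> \<in> space M. V0 \<omega> = - c2} \<inter> {\<omega> \<in> space W. N t \<omega> = n}"
    using start unfolding sp by auto
  ultimately show ?thesis
    unfolding cond_prob_def X_def[symmetric] by (simp only: halves) (simp add: sp)
qed

end

theorem proposition3p1:
  fixes M :: "'a measure" and rate c1 c2 t :: real
    and N :: "real \<Rightarrow> 'a \<Rightarrow> nat" and V0 :: "'a \<Rightarrow> real" and k :: nat
  assumes "telegraph_process M rate N c1 c2 V0"
    and "t > 0" and "k \<ge> 1"
  shows "\<P>(\<omega> in M. telegraph_max c1 c2 V0 N t \<omega> = 0
             \<bar> telegraph_velocity c1 c2 V0 N 0 \<omega> = - c2 \<and> N t \<omega> = 2 * k - 1)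
       = \<P>(\<omega> in M. telegraph_max c1 c2 V0 N t \<omega> = 0
             \<bar> telegraph_velocity c1 c2 V0 N 0 \<omega> = - c2 \<and> N t \<omega> = 2 * k)"
proof -
  interpret telegraph_process M rate N c1 c2 V0 by fact
  have "odd (2 * k - 1)" and k: "Suc (2 * k - 1) = 2 * k"
    using \<open>k \<ge> 1\<close> by simp_all
  from prob_path_max_nonpos_balance[OF c1_pos c2_pos \<open>t > 0\<close> this(1)] show ?thesis
    unfolding cond_prob_start_down[OF \<open>t > 0\<close>] k
    using prob_count_pos[OF \<open>t > 0\<close>, of "2 * k - 1"] prob_count_pos[OF \<open>t > 0\<close>, of "2 * k"]
    by (simp add: frac_eq_eq)
qed

end
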